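(* Let $m\ge3$ and let $\Theta_m$ be the graph with two vertices joined by $m$ parallel edges $e_1,\dots,e_m$ of lengths $\ell_1,\dots,\ell_m>0$, with standard Kirchhoff conditions at both vertices, and assume $\ell=(\ell_1,\dots,\ell_m)$ belongs to the generic class $\mathcal G_{\Theta_m}$. Observe all edges except $e_1$, i.e. let $\omega$ be measurable with $\alpha_1=0$ and $\alpha_j=\ell_j$ for $j\ge2$, where $\alpha_j=|\omega\cap e_j|$, and set $H_1:=\sum_{j=2}^m\ell_j^{-1}$. Then $$C_\infty(\omega;\ell)=\frac{1}{1+\ell_1H_1}.$$ Moreover, $$C_\infty(\omega;\ell)<\min_{2\le j\le m}\frac{\ell_j}{\ell_1+\ell_j},$$ so the exact constant is strictly smaller than every observation ratio $\frac{\alpha_1+\alpha_j}{\ell_1+\ell_j}$ of a two-edge cycle $e_1\cup e_j$ involving the unobserved edge.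
   Context: For a finite compact metric graph $G$ with edge set $E$, lengths $\ell$, and standard Kirchhoff conditions (continuity, vanishing sum of outward derivatives) at every vertex, $-\Delta_{G,\ell}$ acts as $-d^2/dx^2$ on each edge $e\cong[0,\ell_e]$. $C_\infty(\omega;\ell):=\lim_{\Lambda\to\infty}\inf\{\int_\omega|u|^2:\ -\Delta_{G,\ell}u=\lambda u,\ \lambda\ge\Lambda,\ \|u\|_{L^2(G)}=1\}$. **Generic class $\mathcal G_G$.** Orient the edges. For $\theta\in(\mathbb R/2\pi\mathbb Z)^E$ let $N(\theta)$ be the space of families $(A_e,B_e)_{e\in E}$ such that the edge functions $A_e\cos t+B_e\sin t$, having value $A_e$ and outward derivative $B_e$ at the initial endpoint, and value $A_e\cos\theta_e+B_e\sin\theta_e$ and outward derivative $A_e\sin\theta_e-B_e\cos\theta_e$ at the final endpoint, satisfy the Kirchhoff condition at every vertex. The determinant manifold is $\{\theta:N(\theta)\neq0\}$, with singular part $\{\theta:\dim N(\theta)\ge2\}$. $\mathcal G_G$ is the set of $\ell\in(0,\infty)^E$ with rationally independent components whose phase line $\{k\ell\bmod2\pi:k>0\}$ does not meet the singular part; equivalently, in that setting, the positive Laplace spectrum is simple. *)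

theory Defs
  imports "HOL-Analysis.Analysis"
begin

text \<open>
  A finite oriented multigraph is given by its finite types \<open>'e\<close> of edges and \<open>'v\<close> of vertices
  together with the maps \<open>src, tgt :: 'e \<Rightarrow> 'v\<close> sending an edge to its initial and final endpoint.
  The edge \<open>e\<close> of the metric graph is the interval \<open>{0..len e}\<close>; a function on the metric graph is a
  family \<open>u :: 'e \<Rightarrow> real \<Rightarrow> complex\<close> of which only the values \<open>u e x\<close> with \<open>x \<in> {0..len e}\<close> matter,
  and a subset is a family \<open>\<omega> :: 'e \<Rightarrow> real set\<close>.
\<close>

text \<open>
  \<open>a e\<close> and \<open>b e\<close> are the values at the initial and final endpoint of \<open>e\<close>, and \<open>da e\<close> and \<open>db e\<close> are
  the derivatives there in the direction pointing from the endpoint into the edge.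
  A loop contributes both of its ends to its vertex.
\<close>

definition kirchhoff ::
  "('e::finite \<Rightarrow> 'v) \<Rightarrow> ('e \<Rightarrow> 'v) \<Rightarrow> ('e \<Rightarrow> complex) \<Rightarrow> ('e \<Rightarrow> complex) \<Rightarrow>
   ('e \<Rightarrow> complex) \<Rightarrow> ('e \<Rightarrow> complex) \<Rightarrow> bool"
where
  "kirchhoff src tgt a da b db \<longleftrightarrow>
     (\<exists>val. \<forall>e. a e = val (src e) \<and> b e = val (tgt e)) \<and>
     (\<forall>v. (\<Sum>e | src e = v. da e) + (\<Sum>e | tgt e = v. db e) = 0)"

text \<open>
  The solutions of \<open>-\<Delta> u = \<mu> u\<close>. On an edge, an \<open>H\<^sup>2\<close> function with \<open>-u'' = \<mu> u\<close> is a classical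
  solution up to the closed endpoints, so the equation is stated classically.
\<close>

definition laplace_eigen ::
  "('e::finite \<Rightarrow> 'v) \<Rightarrow> ('e \<Rightarrow> 'v) \<Rightarrow> ('e \<Rightarrow> real) \<Rightarrow> real \<Rightarrow> ('e \<Rightarrow> real \<Rightarrow> complex) \<Rightarrow> bool"
where
  "laplace_eigen src tgt len \<mu> u \<longleftrightarrow>
     (\<exists>u'. (\<forall>e. \<forall>x\<in>{0..len e}.
              (u e has_vector_derivative u' e x) (at x within {0..len e}) \<and>
              (u' e has_vector_derivative - (of_real \<mu> * u e x)) (at x within {0..len e})) \<and>
           kirchhoff src tgt (\<lambda>e. u e 0) (\<lambda>e. u' e 0) (\<lambda>e. u e (len e)) (\<lambda>e. - u' e (len e)))"

definition mass_on :: "('e::finite \<Rightarrow> real set) \<Rightarrow> ('e \<Rightarrow> real \<Rightarrow> complex) \<Rightarrow> real" where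
  "mass_on \<omega> u = (\<Sum>e\<in>UNIV. set_lebesgue_integral lebesgue (\<omega> e) (\<lambda>x. (cmod (u e x))\<^sup>2))"

definition L2norm :: "('e::finite \<Rightarrow> real) \<Rightarrow> ('e \<Rightarrow> real \<Rightarrow> complex) \<Rightarrow> real" where
  "L2norm len u = sqrt (mass_on (\<lambda>e. {0..len e}) u)"

definition C_infty ::
  "('e::finite \<Rightarrow> 'v) \<Rightarrow> ('e \<Rightarrow> 'v) \<Rightarrow> ('e \<Rightarrow> real set) \<Rightarrow> ('e \<Rightarrow> real) \<Rightarrow> real"
where
  "C_infty src tgt \<omega> len =
     Lim at_top (\<lambda>\<Lambda>::real.
       Inf {mass_on \<omega> u | u \<mu>. laplace_eigen src tgt len \<mu> u \<and> \<Lambda> \<le> \<mu> \<and> L2norm len u = 1})"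

definition measurable_subset :: "('e \<Rightarrow> real) \<Rightarrow> ('e \<Rightarrow> real set) \<Rightarrow> bool" where
  "measurable_subset len \<omega> \<longleftrightarrow> (\<forall>e. \<omega> e \<in> sets lebesgue \<and> \<omega> e \<subseteq> {0..len e})"

text \<open>
  A family \<open>(A\<^sub>e, B\<^sub>e)\<close> is encoded as one vector \<open>c\<close> with \<open>A\<^sub>e = c $ Inl e\<close> and \<open>B\<^sub>e = c $ Inr e\<close>, so that
  \<open>vec.dim\<close> is its dimension over the complex numbers.
\<close>

definition phase_kernel ::
  "('e::finite \<Rightarrow> 'v) \<Rightarrow> ('e \<Rightarrow> 'v) \<Rightarrow> ('e \<Rightarrow> real) \<Rightarrow> (complex ^ ('e + 'e)) set"
where
  "phase_kernel src tgt \<theta> =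
     {c. kirchhoff src tgt
           (\<lambda>e. c $ Inl e)
           (\<lambda>e. c $ Inr e)
           (\<lambda>e. c $ Inl e * of_real (cos (\<theta> e)) + c $ Inr e * of_real (sin (\<theta> e)))
           (\<lambda>e. c $ Inl e * of_real (sin (\<theta> e)) - c $ Inr e * of_real (cos (\<theta> e)))}"

text \<open>
  Subsets of the torus of phases are represented by their \<open>2\<pi>\<close>-periodic lifts to families of real
  numbers; \<open>phase_kernel\<close> depends on the phases only modulo \<open>2\<pi>\<close>.
\<close>

definition singular_part ::
  "('e::finite \<Rightarrow> 'v) \<Rightarrow> ('e \<Rightarrow> 'v) \<Rightarrow> ('e \<Rightarrow> real) set"
where
  "singular_part src tgt = {\<theta>. vec.dim (phase_kernel src tgt \<theta>) \<ge> 2}"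

definition rationally_independent :: "('e::finite \<Rightarrow> real) \<Rightarrow> bool" where
  "rationally_independent len \<longleftrightarrow>
     (\<forall>q. (\<forall>e. q e \<in> \<rat>) \<longrightarrow> (\<Sum>e\<in>UNIV. q e * len e) = 0 \<longrightarrow> (\<forall>e. q e = 0))"

definition generic_class ::
  "('e::finite \<Rightarrow> 'v) \<Rightarrow> ('e \<Rightarrow> 'v) \<Rightarrow> ('e \<Rightarrow> real) set"
where
  "generic_class src tgt =
     {len. (\<forall>e. 0 < len e) \<and> rationally_independent len \<and>
         (\<forall>k>0. (\<lambda>e. k * len e) \<notin> singular_part src tgt)}"

text \<open>
  The graph with two vertices, \<open>False\<close> and \<open>True\<close>, joined by parallel edges indexed by \<open>'m\<close>,
  all oriented from \<open>False\<close> to \<open>True\<close>.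
\<close>

definition theta_src :: "'m::finite \<Rightarrow> bool" where "theta_src e = False"

definition theta_tgt :: "'m::finite \<Rightarrow> bool" where "theta_tgt e = True"

end

theory Submission
  imports Defs
begin

text \<open>
  For \<open>\<mu> = k\<^sup>2 > 0\<close> a solution of the eigenvalue equation is \<open>A\<^sub>e cos (k x) + B\<^sub>e sin (k x)\<close> on the
  edge \<open>e\<close>. Up to a relative error \<open>O(1/k)\<close> its mass on \<open>e\<close> is \<open>(|A\<^sub>e|\<^sup>2 + |B\<^sub>e|\<^sup>2) \<ell>\<^sub>e / 2\<close>, because the
  oscillating parts of the squared modulus integrate to \<open>O(1/k)\<close>. At the common initial vertex, continuity
  makes all \<open>A\<^sub>e\<close> equal to one number \<open>a\<close>, and the derivative condition says \<open>\<Sum> B\<^sub>e = 0\<close>. So the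
  question becomes how large a share of \<open>\<Sum> (|a|\<^sup>2 + |B\<^sub>e|\<^sup>2) \<ell>\<^sub>e\<close> the unobserved edge \<open>e\<^sub>1\<close> can carry.

  Lower bound. Since \<open>B\<^bsub>e\<^sub>1\<^esub> = - \<Sum>\<^bsub>j \<noteq> e\<^sub>1\<^esub> B\<^sub>j\<close>, the Cauchy-Schwarz inequality with weights \<open>\<ell>\<^sub>j\<close> bounds the
  energy of \<open>e\<^sub>1\<close> by \<open>\<ell>\<^bsub>e\<^sub>1\<^esub> H\<^sub>1\<close> times the energy of the other edges
  (\<open>unobserved_amplitude_bound\<close>), so in the limit at least the share \<open>1 / (1 + \<ell>\<^bsub>e\<^sub>1\<^esub> H\<^sub>1)\<close> is observed
  (\<open>observed_mass_lower_bound\<close>).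

  Upper bound. If \<open>\<Sum> tan (k \<ell>\<^sub>e / 2) = 0\<close>, then \<open>cos (k x) + tan (k \<ell>\<^sub>e / 2) sin (k x)\<close>, which is symmetric
  about the midpoint of each edge, is an eigenfunction (\<open>theta_resonance_eigenfunction\<close>). The lengths being
  rationally independent, Kronecker's theorem together with the monotonicity of the tangent yields
  arbitrarily large such \<open>k\<close> whose tangents are as close as desired to any given numbers \<open>t\<^sub>e\<close> with
  \<open>\<Sum> t\<^sub>e = 0\<close> (\<open>resonance_near\<close>). Equality in Cauchy-Schwarz holds for \<open>t\<^sub>j\<close> proportional to \<open>1 / \<ell>\<^sub>j\<close>; with
  \<open>t\<^sub>j = s / \<ell>\<^sub>j\<close> for \<open>j \<noteq> e\<^sub>1\<close> and \<open>t\<^bsub>e\<^sub>1\<^esub> = - s H\<^sub>1\<close>, the common value \<open>a = 1\<close> becomes negligible as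
  \<open>s \<rightarrow> \<infinity>\<close> and the observed share tends to \<open>1 / (1 + \<ell>\<^bsub>e\<^sub>1\<^esub> H\<^sub>1)\<close> (\<open>infimum_le_limit_constant\<close>).

  The strict inequalities hold because \<open>H\<^sub>1\<close> has, besides \<open>1 / \<ell>\<^sub>j\<close>, at least one more positive term.
\<close>

section \<open>Harmonic oscillation on one edge\<close>

text \<open>
  Rotating the phase vector \<open>(u, u' / k)\<close> back by the angle \<open>k x\<close> gives \<open>(w, z)\<close>, which has derivative
  zero and hence keeps its initial value.
\<close>

lemma harmonic_oscillator_solution:
  fixes u u' :: "real \<Rightarrow> complex"
  assumes "0 < k"
    and u: "\<And>x. x \<in> {0..l} \<Longrightarrow> (u has_vector_derivative u' x) (at x within {0..l})"
    and u': "\<And>x. x \<in> {0..l} \<Longrightarrow>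
      (u' has_vector_derivative - (of_real (k\<^sup>2) * u x)) (at x within {0..l})"
    and x: "x \<in> {0..l}"
  shows "u x = u 0 * of_real (cos (k * x)) + u' 0 / of_real k * of_real (sin (k * x))"
proof -
  define w where "w = (\<lambda>x. u x * of_real (cos (k * x)) - u' x / of_real k * of_real (sin (k * x)))"
  define z where "z = (\<lambda>x. u x * of_real (sin (k * x)) + u' x / of_real k * of_real (cos (k * x)))"
  have dcos: "((\<lambda>x. complex_of_real (cos (k * x))) has_vector_derivative of_real (- k * sin (k * y)))
      (at y within {0..l})" for y
    by (rule has_vector_derivative_of_real) (auto intro!: derivative_eq_intros)
  have dsin: "((\<lambda>x. complex_of_real (sin (k * x))) has_vector_derivative of_real (k * cos (k * y)))
      (at y within {0..l})" for y
    by (rule has_vector_derivative_of_real) (auto intro!: derivative_eq_intros)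
  have w: "(w has_vector_derivative 0) (at y within {0..l})" if y: "y \<in> {0..l}" for y
    unfolding w_def using \<open>0 < k\<close>
    by (auto intro!: derivative_eq_intros u[OF y] u'[OF y] dcos dsin has_vector_derivative_mult
        has_vector_derivative_divide simp: field_simps power2_eq_square)
  have z: "(z has_vector_derivative 0) (at y within {0..l})" if y: "y \<in> {0..l}" for y
    unfolding z_def using \<open>0 < k\<close>
    by (auto intro!: derivative_eq_intros u[OF y] u'[OF y] dcos dsin has_vector_derivative_mult
        has_vector_derivative_divide simp: field_simps power2_eq_square)
  have "0 \<in> {0..l}" using x by auto
  have "w x = w 0"
    using has_vector_derivative_zero_constant[OF convex_real_interval(5) w] x \<open>0 \<in> {0..l}\<close> by metis
  moreover have "z x = z 0"
    using has_vector_derivative_zero_constant[OF convex_real_interval(5) z] x \<open>0 \<in> {0..l}\<close> by metis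
  moreover have "w 0 = u 0" "z 0 = u' 0 / of_real k" by (simp_all add: w_def z_def)
  moreover have "u x = w x * of_real (cos (k * x)) + z x * of_real (sin (k * x))"
  proof -
    have *: "complex_of_real (cos (k * x)) ^ 2 + complex_of_real (sin (k * x)) ^ 2 = 1"
      by (metis of_real_1 of_real_add of_real_power sin_cos_squared_add2)
    have "w x * of_real (cos (k * x)) + z x * of_real (sin (k * x)) =
       u x * (complex_of_real (cos (k * x)) ^ 2 + complex_of_real (sin (k * x)) ^ 2)"
      by (simp add: w_def z_def algebra_simps power2_eq_square)
    then show ?thesis using * by simp
  qed
  ultimately show ?thesis by simp
qed

lemma cmod_wave_squared:
  "(cmod (A * of_real c + B * of_real s))\<^sup>2 =
     (cmod A)\<^sup>2 * c\<^sup>2 + (cmod B)\<^sup>2 * s\<^sup>2 + 2 * Re (A * cnj B) * c * s"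
  unfolding cmod_power2 by (simp add: power2_eq_square algebra_simps)

text \<open>
  The squared modulus is its mean \<open>(|A|\<^sup>2 + |B|\<^sup>2) / 2\<close> plus terms of frequency \<open>2 k\<close>, whose
  primitives carry a factor \<open>1 / k\<close>.
\<close>

lemma wave_mass_bound:
  fixes A B :: complex
  assumes "0 < k" "0 \<le> l"
  shows "\<bar>set_lebesgue_integral lebesgue {0..l}
            (\<lambda>x. (cmod (A * of_real (cos (k * x)) + B * of_real (sin (k * x))))\<^sup>2)
          - ((cmod A)\<^sup>2 + (cmod B)\<^sup>2) * l / 2\<bar> \<le> ((cmod A)\<^sup>2 + (cmod B)\<^sup>2) / k"
proof -
  define f where "f = (\<lambda>x. (cmod (A * of_real (cos (k * x)) + B * of_real (sin (k * x))))\<^sup>2)"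
  define E where "E = (cmod A)\<^sup>2 + (cmod B)\<^sup>2"
  define D where "D = (cmod A)\<^sup>2 - (cmod B)\<^sup>2"
  define R where "R = Re (A * cnj B)"
  define F where "F = (\<lambda>x. E * x / 2 + D * (sin (k * x) * cos (k * x)) / (2 * k) + R * (sin (k * x))\<^sup>2 / k)"
  have f: "f x = (cmod A)\<^sup>2 * (cos (k * x))\<^sup>2 + (cmod B)\<^sup>2 * (sin (k * x))\<^sup>2
      + 2 * R * cos (k * x) * sin (k * x)" for x
    unfolding f_def R_def by (rule cmod_wave_squared)
  have "(F has_vector_derivative f x) (at x within {0..l})" for x
  proof -
    have "(F has_real_derivative
        E / 2 + D * (k * cos (k * x) * cos (k * x) - k * sin (k * x) * sin (k * x)) / (2 * k)
          + R * (2 * sin (k * x) * (k * cos (k * x))) / k) (at x within {0..l})"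
      unfolding F_def using \<open>0 < k\<close>
      by (auto intro!: derivative_eq_intros simp: field_simps power2_eq_square)
    moreover have "E / 2 + D * (k * cos (k * x) * cos (k * x) - k * sin (k * x) * sin (k * x)) / (2 * k)
          + R * (2 * sin (k * x) * (k * cos (k * x))) / k = f x"
    proof -
      have s: "(sin (k * x))\<^sup>2 = 1 - (cos (k * x))\<^sup>2" by (simp add: sin_squared_eq)
      have "D * (k * cos (k * x) * cos (k * x) - k * sin (k * x) * sin (k * x)) / (2 * k)
          = D * ((cos (k * x))\<^sup>2 - (sin (k * x))\<^sup>2) / 2"
        using \<open>0 < k\<close> by (simp add: field_simps power2_eq_square)
      moreover have "R * (2 * sin (k * x) * (k * cos (k * x))) / k = 2 * R * cos (k * x) * sin (k * x)"
        using \<open>0 < k\<close> by (simp add: field_simps)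
      ultimately show ?thesis
        unfolding f s E_def D_def by (simp add: field_simps)
    qed
    ultimately show ?thesis
      by (simp add: has_real_derivative_iff_has_vector_derivative)
  qed
  then have "(f has_integral F l - F 0) {0..l}"
    using fundamental_theorem_of_calculus[OF \<open>0 \<le> l\<close>] by blast
  then have int: "f integrable_on {0..l}" "integral {0..l} f = F l"
    by (auto simp: integrable_on_def F_def)
  have "f absolutely_integrable_on {0..l}"
    by (rule nonnegative_absolutely_integrable_1[OF int(1)]) (simp add: f_def)
  then have I: "set_lebesgue_integral lebesgue {0..l} f = F l"
    using set_lebesgue_integral_eq_integral(2) int(2) by metis
  have E0: "0 \<le> E" by (simp add: E_def)
  have DE: "\<bar>D\<bar> \<le> E"
    unfolding D_def E_def by (smt (verit) zero_le_power2)
  have RE: "\<bar>R\<bar> \<le> E / 2"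
  proof -
    have "\<bar>R\<bar> \<le> cmod A * cmod B"
      unfolding R_def by (metis abs_Re_le_cmod complex_mod_cnj norm_mult)
    moreover have "2 * (cmod A * cmod B) \<le> E"
      unfolding E_def using sum_squares_bound[of "cmod A" "cmod B"] by simp
    ultimately show ?thesis by simp
  qed
  have 1: "\<bar>D * (sin (k * l) * cos (k * l)) / (2 * k)\<bar> \<le> E / (2 * k)"
  proof -
    have "\<bar>sin (k * l) * cos (k * l)\<bar> \<le> 1"
      by (simp add: abs_mult mult_le_one)
    then have "\<bar>D\<bar> * \<bar>sin (k * l) * cos (k * l)\<bar> \<le> E * 1"
      using DE by (intro mult_mono) auto
    then show ?thesis using \<open>0 < k\<close> by (simp add: abs_mult divide_right_mono)
  qed
  have 2: "\<bar>R * (sin (k * l))\<^sup>2 / k\<bar> \<le> E / (2 * k)"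
  proof -
    have "\<bar>R\<bar> * (sin (k * l))\<^sup>2 \<le> E / 2 * 1"
      using RE by (intro mult_mono) (auto simp: abs_square_le_1)
    then show ?thesis using \<open>0 < k\<close> by (simp add: abs_mult field_simps)
  qed
  have "F l - E * l / 2 = D * (sin (k * l) * cos (k * l)) / (2 * k) + R * (sin (k * l))\<^sup>2 / k"
    by (simp add: F_def)
  moreover have "E / (2 * k) + E / (2 * k) = E / k" using \<open>0 < k\<close> by (simp add: field_simps)
  ultimately have "\<bar>F l - E * l / 2\<bar> \<le> E / k"
    using 1 2 by linarith
  then show ?thesis using I by (simp add: f_def E_def)
qed

section \<open>Simultaneous approximation and resonances\<close>

text \<open>
  Kronecker's theorem controls neither the sign nor the size of the time \<open>t\<close>. Adding a large common
  almost-period \<open>q M\<close> of all the \<open>len e\<close>, supplied by Dirichlet's simultaneous approximation theorem,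
  pushes \<open>t\<close> beyond any \<open>K\<close> and spoils the approximation only slightly.
\<close>

lemma Kronecker_rationally_independent:
  fixes len \<alpha> :: "'m::finite \<Rightarrow> real"
  assumes ri: "rationally_independent len" and "0 < \<epsilon>"
  obtains t :: real and h :: "'m \<Rightarrow> int"
  where "K \<le> t" "\<And>e. \<bar>t * len e - of_int (h e) - \<alpha> e\<bar> < \<epsilon>"
proof -
  define n where "n = CARD('m)"
  obtain i :: "nat \<Rightarrow> 'm" where i: "bij_betw i {..<n} UNIV"
    using ex_bij_betw_nat_finite[of "UNIV :: 'm set"] by (auto simp: n_def atLeast0LessThan)
  have inj: "inj len"
  proof (rule injI, rule ccontr)
    fix a b assume ab: "len a = len b" "a \<noteq> b"
    define q where "q = (\<lambda>e. if e = a then 1 else if e = b then - 1 else (0::real))"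
    have "(\<Sum>e\<in>UNIV. q e * len e) = (\<Sum>e\<in>{a,b}. q e * len e)"
      by (rule sum.mono_neutral_right) (auto simp: q_def)
    also have "\<dots> = 0" using ab by (simp add: q_def)
    finally have "(\<Sum>e\<in>UNIV. q e * len e) = 0" .
    moreover have "\<forall>e. q e \<in> \<rat>" by (simp add: q_def)
    ultimately have "\<forall>e. q e = 0" using ri unfolding rationally_independent_def by blast
    then show False by (auto simp: q_def dest: spec[of _ a])
  qed
  interpret Modules.module "\<lambda>r. (*) (real_of_int r)"
    by (simp add: Modules.module.intro distrib_left mult.commute)
  have "independent (range len)"
    unfolding dependent_explicit
  proof safe
    fix T u v
    assume T: "T \<subseteq> range len" and s: "(\<Sum>v\<in>T. real_of_int (u v) * v) = 0" and v: "v \<in> T" "u v \<noteq> 0"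
    define q where "q = (\<lambda>e. if len e \<in> T then real_of_int (u (len e)) else 0)"
    have "(\<Sum>e\<in>UNIV. q e * len e) = (\<Sum>e\<in>len -` T. real_of_int (u (len e)) * len e)"
      by (rule sum.mono_neutral_cong_right) (auto simp: q_def)
    also have "\<dots> = (\<Sum>v\<in>T. real_of_int (u v) * v)"
      using T inj by (intro sum.reindex_bij_betw) (auto simp: bij_betw_def inj_on_def)
    finally have "(\<Sum>e\<in>UNIV. q e * len e) = 0" using s by simp
    moreover have "\<forall>e. q e \<in> \<rat>" by (simp add: q_def)
    ultimately have "\<forall>e. q e = 0" using ri unfolding rationally_independent_def by blast
    moreover obtain e where "v = len e" using T v by auto
    ultimately show False using v by (auto simp: q_def dest!: spec[of _ e])
  qed
  then have ind: "independent ((len \<circ> i) ` {..<n})"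
    using bij_betw_imp_surj_on[OF i] by (metis image_comp)
  have "inj_on (len \<circ> i) {..<n}"
    using i inj by (auto simp: bij_betw_def inj_on_def)
  then obtain t h where th: "\<And>j. j < n \<Longrightarrow> \<bar>t * (len \<circ> i) j - of_int (h j) - (\<alpha> \<circ> i) j\<bar> < \<epsilon> / 2"
    using Kronecker_thm_1[OF ind, of "\<epsilon> / 2" "\<alpha> \<circ> i"] \<open>0 < \<epsilon>\<close> by auto
  define M where "M = \<bar>t\<bar> + \<bar>K\<bar>"
  obtain N :: nat where N: "N > 0" "1 / N < \<epsilon> / 2"
    by (metis \<open>0 < \<epsilon>\<close> gr_zeroI half_gt_zero inverse_eq_divide real_arch_inverse)
  obtain q p where q: "0 < q" "\<And>j. j < n \<Longrightarrow> \<bar>of_int q * (M * len (i j)) - of_int (p j)\<bar> < 1 / N"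
    using Dirichlet_approx_simult[OF N(1), of n "\<lambda>j. M * len (i j)"] by metis
  have "1 * M \<le> of_int q * M" using q(1) by (intro mult_right_mono) (auto simp: M_def)
  moreover have "K - t \<le> M" by (simp add: M_def)
  ultimately have K: "K \<le> t + of_int q * M" by linarith
  show thesis
  proof (rule that[OF K])
    fix e
    define j where "j = the_inv_into {..<n} i e"
    have j: "j < n" "i j = e"
      using i unfolding j_def by (auto simp: bij_betw_def f_the_inv_into_f intro: the_inv_into_into[of _ _ _ "{..<n}", simplified])
    have "\<bar>t * len e - of_int (h j) - \<alpha> e\<bar> < \<epsilon> / 2" "\<bar>of_int q * (M * len e) - of_int (p j)\<bar> < \<epsilon> / 2"
      using th[OF j(1)] q(2)[OF j(1)] j(2) N(2) by auto
    moreover have "(t + of_int q * M) * len e - of_int (h j + p j) - \<alpha> e =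
        (t * len e - of_int (h j) - \<alpha> e) + (of_int q * (M * len e) - of_int (p j))"
      by (simp add: algebra_simps)
    ultimately have "\<bar>(t + of_int q * M) * len e - of_int (h j + p j) - \<alpha> e\<bar> < \<epsilon>"
      by linarith
    then show "\<bar>(t + of_int q * M) * len e
        - of_int (h (the_inv_into {..<n} i e) + p (the_inv_into {..<n} i e)) - \<alpha> e\<bar> < \<epsilon>"
      unfolding j_def .
  qed
qed

text \<open>
  Kronecker's theorem brings all the phases \<open>k len e / 2\<close> within \<open>\<rho>\<close> of \<open>arctan (t e)\<close> modulo \<open>\<pi>\<close>, but only
  approximately. Moving \<open>k\<close> by \<open>\<plusminus> h\<close> shifts every phase past its target in the same direction, and
  the tangent is increasing, so the sum of the tangents changes sign from \<open>- h\<close> to \<open>h\<close> and vanishes exactly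
  somewhere in between. Here \<open>h\<close> is so small that all phases stay within the radius \<open>r e\<close> on which
  the tangent is within \<open>\<delta>\<close> of \<open>t e\<close>.
\<close>

lemma resonance_near:
  fixes len t :: "'m::finite \<Rightarrow> real"
  assumes pos: "\<And>e. 0 < len e" and ri: "rationally_independent len"
    and t: "(\<Sum>e\<in>UNIV. t e) = 0" and "0 < \<delta>"
  obtains k where "K \<le> k" "(\<Sum>e\<in>UNIV. tan (k * len e / 2)) = 0"
    "\<And>e. cos (k * len e / 2) \<noteq> 0" "\<And>e. \<bar>tan (k * len e / 2) - t e\<bar> < \<delta>"
proof -
  have "\<exists>r>0. \<forall>x. \<bar>x - arctan (t e)\<bar> < r \<longrightarrow> \<bar>x\<bar> < pi / 2 \<and> \<bar>tan x - t e\<bar> < \<delta>" for e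
  proof -
    have "cos (arctan (t e)) \<noteq> 0" by simp
    then have "isCont tan (arctan (t e))" by (rule isCont_tan)
    then obtain r where r: "r > 0" "\<And>x. \<bar>x - arctan (t e)\<bar> < r \<Longrightarrow> \<bar>tan x - t e\<bar> < \<delta>"
      using \<open>0 < \<delta>\<close> unfolding continuous_at_eps_delta dist_real_def tan_arctan by metis
    have "0 < pi / 2 - \<bar>arctan (t e)\<bar>" using arctan_bounded[of "t e"] by linarith
    then show ?thesis
      using r by (intro exI[of _ "min r (pi / 2 - \<bar>arctan (t e)\<bar>)"]) auto
  qed
  then obtain r where r: "\<And>e. 0 < r e"
    "\<And>e x. \<bar>x - arctan (t e)\<bar> < r e \<Longrightarrow> \<bar>x\<bar> < pi / 2"
    "\<And>e x. \<bar>x - arctan (t e)\<bar> < r e \<Longrightarrow> \<bar>tan x - t e\<bar> < \<delta>" by metis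
  define h where "h = Min (range (\<lambda>e. r e / (2 * len e)))"
  define \<rho> where "\<rho> = Min (range (\<lambda>e. h * len e / 2))"
  have h0: "0 < h" unfolding h_def using r(1) pos by (subst Min_gr_iff) auto
  have h_le: "h * len e \<le> r e / 2" for e
  proof -
    have "h \<le> r e / (2 * len e)" unfolding h_def by (rule Min_le) auto
    then show ?thesis using pos[of e] by (simp add: field_simps)
  qed
  have \<rho>0: "0 < \<rho>" unfolding \<rho>_def using h0 pos by (subst Min_gr_iff) auto
  have \<rho>_le: "\<rho> \<le> h * len e / 2" for e unfolding \<rho>_def by (rule Min_le) auto
  \<comment> \<open>The time \<open>s\<close> corresponds to \<open>k = 2 \<pi> s\<close>, so that \<open>k len e / 2 = \<pi> (s len e)\<close>.\<close>
  obtain s z where s: "(\<bar>K\<bar> + h) / (2 * pi) \<le> s"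
    and z: "\<And>e. \<bar>s * len e - of_int (z e) - arctan (t e) / pi\<bar> < \<rho> / pi"
    using Kronecker_rationally_independent[OF ri, of "\<rho> / pi" "(\<bar>K\<bar> + h) / (2 * pi)" "\<lambda>e. arctan (t e) / pi"]
      \<rho>0 by auto
  define y where "y = (\<lambda>e. s * pi * len e - of_int (z e) * pi)"
  have y: "\<bar>y e - arctan (t e)\<bar> < \<rho>" for e
  proof -
    have "y e - arctan (t e) = pi * (s * len e - of_int (z e) - arctan (t e) / pi)"
      by (simp add: y_def field_simps)
    then have "\<bar>y e - arctan (t e)\<bar> = pi * \<bar>s * len e - of_int (z e) - arctan (t e) / pi\<bar>"
      by (simp add: abs_mult)
    then show ?thesis using z[of e] by (simp add: field_simps)
  qed
  have near: "\<bar>y e + x * len e / 2 - arctan (t e)\<bar> < r e" if "\<bar>x\<bar> \<le> h" for e x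
  proof -
    have "\<bar>x * len e / 2\<bar> \<le> h * len e / 2"
      using that pos[of e] by (simp add: abs_mult)
    then show ?thesis using y[of e] \<rho>_le[of e] h_le[of e] r(1)[of e] by linarith
  qed
  define G where "G = (\<lambda>x. \<Sum>e\<in>UNIV. tan (y e + x * len e / 2))"
  have "tan (arctan (t e)) < tan (y e + h * len e / 2)" for e
    using y[of e] \<rho>_le[of e] r(2)[OF near[of h e]] h0 arctan_bounded[of "t e"]
    by (intro tan_monotone) linarith+
  then have "0 \<le> G h" using t unfolding G_def
    by (metis (no_types, lifting) less_eq_real_def sum_mono tan_arctan)
  moreover have "tan (y e + (- h) * len e / 2) < tan (arctan (t e))" for e
  proof (rule tan_monotone)
    have "\<bar>y e + (- h) * len e / 2\<bar> < pi / 2" using r(2)[OF near[of "-h" e]] h0 by simp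
    then show "- (pi / 2) < y e + (- h) * len e / 2" by linarith
    show "y e + (- h) * len e / 2 < arctan (t e)" using y[of e] \<rho>_le[of e] by simp
    show "arctan (t e) < pi / 2" by (rule arctan_ubound)
  qed
  then have "G (- h) \<le> 0" using t unfolding G_def
    by (metis (no_types, lifting) less_eq_real_def sum_mono tan_arctan)
  moreover have "continuous_on {-h..h} G"
    unfolding G_def
  proof (intro continuous_intros ballI)
    fix e x assume "x \<in> {-h..h}"
    then have "\<bar>y e + x * len e / 2\<bar> < pi / 2" by (intro r(2)[of _ e] near) auto
    then show "cos (y e + x * len e / 2) \<noteq> 0"
      by (intro order.strict_implies_not_eq[symmetric, OF cos_gt_zero_pi]) linarith+
  qed auto
  ultimately obtain x where x: "- h \<le> x" "x \<le> h" "G x = 0"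
    using IVT'[of G "-h" 0 h] h0 by auto
  have ax: "\<bar>x\<bar> \<le> h" using x by auto
  have eq: "(2 * pi * s + x) * len e / 2 = y e + x * len e / 2 + of_int (z e) * pi" for e
    by (simp add: y_def field_simps)
  have tan_eq: "tan ((2 * pi * s + x) * len e / 2) = tan (y e + x * len e / 2)" for e
    unfolding eq by simp
  show thesis
  proof (rule that[of "2 * pi * s + x"])
    show "K \<le> 2 * pi * s + x" using s x by (simp add: field_simps)
    show "(\<Sum>e\<in>UNIV. tan ((2 * pi * s + x) * len e / 2)) = 0"
      using x(3) unfolding tan_eq G_def .
    show "\<bar>tan ((2 * pi * s + x) * len e / 2) - t e\<bar> < \<delta>" for e
      unfolding tan_eq by (rule r(3)[OF near[OF ax]])
    have "0 < cos (y e + x * len e / 2)" for e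
      using r(2)[OF near[OF ax, of e]] by (intro cos_gt_zero_pi) linarith+
    moreover have "\<bar>cos ((2 * pi * s + x) * len e / 2)\<bar> = \<bar>cos (y e + x * len e / 2)\<bar>" for e
      unfolding eq cos_add[of _ "of_int (z e) * pi"]
      by (simp add: abs_mult mult.commute[of _ pi])
    ultimately show "cos ((2 * pi * s + x) * len e / 2) \<noteq> 0" for e
      by (metis abs_zero abs_eq_0 less_irrefl)
  qed
qed

section \<open>Eigenfunctions of the theta graph\<close>

text \<open>
  All edges start at one vertex and end at the other, so the vertex conditions decouple into one set
  for the initial and one for the final endpoints.
\<close>

lemma kirchhoff_theta:
  "kirchhoff theta_src theta_tgt a da b db \<longleftrightarrow>
     (\<exists>p q. \<forall>e. a e = p \<and> b e = q) \<and> sum da UNIV = 0 \<and> sum db UNIV = 0"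
proof -
  have "(\<exists>val. \<forall>e. a e = val False \<and> b e = val True) \<longleftrightarrow> (\<exists>p q. \<forall>e. a e = p \<and> b e = q)"
  proof safe
    fix p q assume "\<forall>e. a e = p \<and> b e = q"
    then show "\<exists>val. \<forall>e. a e = val False \<and> b e = val True"
      by (intro exI[of _ "\<lambda>v. if v then q else p"]) simp
  qed blast
  then show ?thesis
    by (auto simp: kirchhoff_def theta_src_def theta_tgt_def all_bool_eq)
qed

text \<open>
  Continuity at the initial vertex makes the cosine coefficients equal, and the derivative condition
  there becomes \<open>\<Sum> B e = 0\<close> after division by \<open>k\<close>.
\<close>

lemma theta_eigenfunction_wave:
  assumes eig: "laplace_eigen theta_src theta_tgt len (k\<^sup>2) u" and "0 < k"
  shows "\<exists>a B. sum B UNIV = 0 \<and> (\<forall>e. \<forall>x\<in>{0..len e}.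
    u e x = a * of_real (cos (k * x)) + B e * of_real (sin (k * x)))"
proof -
  obtain u' where
    u: "\<And>e x. x \<in> {0..len e} \<Longrightarrow> (u e has_vector_derivative u' e x) (at x within {0..len e})"
    and u': "\<And>e x. x \<in> {0..len e} \<Longrightarrow>
      (u' e has_vector_derivative - (of_real (k\<^sup>2) * u e x)) (at x within {0..len e})"
    and K: "kirchhoff theta_src theta_tgt (\<lambda>e. u e 0) (\<lambda>e. u' e 0) (\<lambda>e. u e (len e)) (\<lambda>e. - u' e (len e))"
    using eig unfolding laplace_eigen_def by blast
  obtain a where a: "\<And>e. u e 0 = a" and s: "(\<Sum>e\<in>UNIV. u' e 0) = 0"
    using K unfolding kirchhoff_theta by blast
  show ?thesis
  proof (intro exI conjI allI ballI)
    show "(\<Sum>e\<in>UNIV. u' e 0 / of_real k) = 0" using s by (simp flip: sum_divide_distrib)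
    show "u e x = a * of_real (cos (k * x)) + u' e 0 / of_real k * of_real (sin (k * x))"
      if "x \<in> {0..len e}" for e x
      using harmonic_oscillator_solution[OF \<open>0 < k\<close> u u' that] a by simp
  qed
qed

text \<open>
  With \<open>\<phi> = k len e / 2\<close> the function on \<open>e\<close> is \<open>c cos (k x - \<phi>) / cos \<phi>\<close>, even about the midpoint of the
  edge. It therefore takes the value \<open>c\<close> and has the outward derivative \<open>c k tan \<phi>\<close> at both ends, and the
  vanishing of the sum of tangents is the Kirchhoff condition at either vertex. The factor \<open>c\<close> leaves
  room for normalisation.
\<close>

lemma theta_resonance_eigenfunction:
  fixes c :: complex
  assumes cos: "\<And>e. cos (k * len e / 2) \<noteq> 0" and tan: "(\<Sum>e\<in>UNIV. tan (k * len e / 2)) = 0"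
  shows "laplace_eigen theta_src theta_tgt len (k\<^sup>2)
    (\<lambda>e x. c * of_real (cos (k * x)) + (c * of_real (tan (k * len e / 2))) * of_real (sin (k * x)))"
proof -
  define \<tau> where "\<tau> = (\<lambda>e. tan (k * len e / 2))"
  define u where "u = (\<lambda>e x. cos (k * x) + \<tau> e * sin (k * x))"
  define u' where "u' = (\<lambda>e x. - k * sin (k * x) + k * \<tau> e * cos (k * x))"
  have u: "((\<lambda>x. c * of_real (u e x)) has_vector_derivative c * of_real (u' e x)) (at x within S)" for e x S
    unfolding u_def u'_def
    by (intro has_vector_derivative_mult_right has_vector_derivative_of_real)
       (auto intro!: derivative_eq_intros simp: algebra_simps)
  have u': "((\<lambda>x. c * of_real (u' e x)) has_vector_derivative - (of_real (k\<^sup>2) * (c * of_real (u e x))))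
      (at x within S)" for e x S
  proof -
    have "((\<lambda>x. c * of_real (u' e x)) has_vector_derivative c * of_real (- (k\<^sup>2 * u e x))) (at x within S)"
      unfolding u_def u'_def
      by (intro has_vector_derivative_mult_right has_vector_derivative_of_real)
         (auto intro!: derivative_eq_intros simp: algebra_simps power2_eq_square)
    then show ?thesis by (simp add: mult_ac)
  qed
  have ends: "u e (len e) = 1" "u' e (len e) = - k * \<tau> e" for e
  proof -
    define \<phi> where "\<phi> = k * len e / 2"
    have \<phi>: "k * len e = 2 * \<phi>" "cos \<phi> \<noteq> 0" using cos[of e] by (simp_all add: \<phi>_def)
    have \<tau>: "\<tau> e * cos \<phi> = sin \<phi>" using \<phi>(2) by (simp add: \<tau>_def \<phi>_def tan_def)
    have "u e (len e) = cos (2 * \<phi>) + 2 * sin \<phi> * (\<tau> e * cos \<phi>)"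
      by (simp add: u_def \<phi> sin_double)
    also have "\<dots> = 1" unfolding \<tau> by (simp add: cos_double_sin power2_eq_square)
    finally show "u e (len e) = 1" .
    have "u' e (len e) = k * (- 2 * sin \<phi> * cos \<phi> + \<tau> e * (2 * (cos \<phi>)\<^sup>2 - 1))"
      unfolding u'_def \<phi> sin_double cos_double_cos by (simp add: algebra_simps)
    also have "\<dots> = k * (- 2 * sin \<phi> * cos \<phi> + 2 * (\<tau> e * cos \<phi>) * cos \<phi> - \<tau> e)"
      by (simp add: algebra_simps power2_eq_square)
    also have "\<dots> = - k * \<tau> e" unfolding \<tau> by simp
    finally show "u' e (len e) = - k * \<tau> e" .
  qed
  have s: "(\<Sum>e\<in>UNIV. c * of_real (k * \<tau> e)) = 0"
    using tan unfolding \<tau>_def[symmetric] by (simp flip: sum_distrib_left of_real_sum)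
  have "kirchhoff theta_src theta_tgt (\<lambda>e. c * of_real (u e 0)) (\<lambda>e. c * of_real (u' e 0))
      (\<lambda>e. c * of_real (u e (len e))) (\<lambda>e. - (c * of_real (u' e (len e))))"
    unfolding kirchhoff_theta ends using s by (auto simp: u_def u'_def)
  then have "laplace_eigen theta_src theta_tgt len (k\<^sup>2) (\<lambda>e x. c * of_real (u e x))"
    unfolding laplace_eigen_def using u u' by (intro exI[of _ "\<lambda>e x. c * of_real (u' e x)"]) simp
  then show ?thesis by (simp add: u_def \<tau>_def algebra_simps)
qed

section \<open>Observed mass\<close>

lemma set_integral_null_observation:
  fixes f :: "real \<Rightarrow> real"
  assumes "S \<in> sets lebesgue" "S \<subseteq> {a..b}" "measure lebesgue S = 0"
  shows "set_lebesgue_integral lebesgue S f = 0"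
proof -
  have "S \<in> lmeasurable"
    using assms bounded_subset[OF bounded_closed_interval] by (intro bounded_set_imp_lmeasurable) auto
  then have "S \<in> null_sets lebesgue"
    using assms emeasure_eq_measure2[of S lebesgue] by (intro null_setsI) auto
  then have "AE x in lebesgue. x \<notin> S" by (rule AE_not_in)
  then show ?thesis
    unfolding set_lebesgue_integral_def by (intro integral_eq_zero_AE) auto
qed

lemma set_integral_full_observation:
  fixes f :: "real \<Rightarrow> real"
  assumes S: "S \<in> sets lebesgue" "S \<subseteq> {a..b}" "measure lebesgue S = b - a" and "a \<le> b"
    and f: "continuous_on {a..b} f"
  shows "set_lebesgue_integral lebesgue S f = set_lebesgue_integral lebesgue {a..b} f"
proof (rule set_integral_cong_set)
  have int: "set_integrable lebesgue {a..b} f"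
    using absolutely_integrable_continuous_real[OF f] .
  then show "set_borel_measurable lebesgue {a..b} f"
    unfolding set_borel_measurable_def set_integrable_def by (rule borel_measurable_integrable)
  have "set_integrable lebesgue S f" using set_integrable_subset[OF int S(1,2)] .
  then show "set_borel_measurable lebesgue S f"
    unfolding set_borel_measurable_def set_integrable_def by (rule borel_measurable_integrable)
  have "S \<in> lmeasurable"
    using S bounded_subset[OF bounded_closed_interval] by (intro bounded_set_imp_lmeasurable) auto
  then have "measure lebesgue ({a..b} - S) = 0"
    using S \<open>a \<le> b\<close> by (subst measurable_measure_Diff) auto
  moreover have "{a..b} - S \<in> lmeasurable"
    using S by (intro fmeasurable.Diff \<open>S \<in> lmeasurable\<close>) auto
  ultimately have "{a..b} - S \<in> null_sets lebesgue"
    using emeasure_eq_measure2[of "{a..b} - S" lebesgue] by (intro null_setsI) auto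
  then have "AE x in lebesgue. x \<notin> {a..b} - S" by (rule AE_not_in)
  then show "AE x in lebesgue. (x \<in> {a..b}) = (x \<in> S)"
    by eventually_elim (use S in auto)
qed

lemma mass_on_all_but_one_edge:
  fixes len :: "'m::finite \<Rightarrow> real"
  assumes "measurable_subset len \<omega>" "\<And>e. 0 < len e"
    and "measure lebesgue (\<omega> e\<^sub>1) = 0" "\<And>j. j \<noteq> e\<^sub>1 \<Longrightarrow> measure lebesgue (\<omega> j) = len j"
    and u: "\<And>e. continuous_on {0..len e} (u e)"
  shows "mass_on \<omega> u =
    (\<Sum>j\<in>UNIV - {e\<^sub>1}. set_lebesgue_integral lebesgue {0..len j} (\<lambda>x. (cmod (u j x))\<^sup>2))"
proof -
  have \<omega>: "\<omega> e \<in> sets lebesgue" "\<omega> e \<subseteq> {0..len e}" for e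
    using assms(1) by (auto simp: measurable_subset_def)
  have "mass_on \<omega> u = set_lebesgue_integral lebesgue (\<omega> e\<^sub>1) (\<lambda>x. (cmod (u e\<^sub>1 x))\<^sup>2)
      + (\<Sum>j\<in>UNIV - {e\<^sub>1}. set_lebesgue_integral lebesgue (\<omega> j) (\<lambda>x. (cmod (u j x))\<^sup>2))"
    unfolding mass_on_def by (rule sum.remove) auto
  also have "set_lebesgue_integral lebesgue (\<omega> e\<^sub>1) (\<lambda>x. (cmod (u e\<^sub>1 x))\<^sup>2) = 0"
    using set_integral_null_observation[OF \<omega> assms(3)] .
  also have "(\<Sum>j\<in>UNIV - {e\<^sub>1}. set_lebesgue_integral lebesgue (\<omega> j) (\<lambda>x. (cmod (u j x))\<^sup>2)) =
    (\<Sum>j\<in>UNIV - {e\<^sub>1}. set_lebesgue_integral lebesgue {0..len j} (\<lambda>x. (cmod (u j x))\<^sup>2))"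
    using assms(2,4)
    by (intro sum.cong refl set_integral_full_observation \<omega> continuous_intros u)
       (auto simp: less_imp_le)
  finally show ?thesis by simp
qed

lemma continuous_on_eigenfunction:
  assumes "laplace_eigen src tgt len \<mu> u"
  shows "continuous_on {0..len e} (u e)"
proof -
  obtain u' where "\<And>x. x \<in> {0..len e} \<Longrightarrow> (u e has_vector_derivative u' e x) (at x within {0..len e})"
    using assms unfolding laplace_eigen_def by blast
  then show ?thesis
    unfolding continuous_on_eq_continuous_within using has_vector_derivative_continuous by blast
qed

text \<open>
  The error is relative to the mean mass, so that it passes unchanged to ratios of masses, whatever
  the size of the amplitudes.
\<close>

lemma edge_mass_asymptotics:
  assumes "0 < k" "0 < l" and \<eta>: "2 / (k * l) \<le> \<eta>"
    and u: "\<And>x. x \<in> {0..l} \<Longrightarrow> u x = a * of_real (cos (k * x)) + b * of_real (sin (k * x))"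
  shows "\<bar>set_lebesgue_integral lebesgue {0..l} (\<lambda>x. (cmod (u x))\<^sup>2)
    - ((cmod a)\<^sup>2 + (cmod b)\<^sup>2) * l / 2\<bar> \<le> \<eta> * (((cmod a)\<^sup>2 + (cmod b)\<^sup>2) * l / 2)"
proof -
  define E where "E = (cmod a)\<^sup>2 + (cmod b)\<^sup>2"
  have "set_lebesgue_integral lebesgue {0..l} (\<lambda>x. (cmod (u x))\<^sup>2) = set_lebesgue_integral lebesgue {0..l}
      (\<lambda>x. (cmod (a * of_real (cos (k * x)) + b * of_real (sin (k * x))))\<^sup>2)"
    using u by (intro set_lebesgue_integral_cong) auto
  moreover have "E / k \<le> \<eta> * (E * l / 2)"
  proof -
    have "E / k = 2 / (k * l) * (E * l / 2)" using assms by (simp add: field_simps)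
    also have "\<dots> \<le> \<eta> * (E * l / 2)" using \<eta> \<open>0 < l\<close> by (intro mult_right_mono) (auto simp: E_def)
    finally show ?thesis .
  qed
  ultimately show ?thesis
    using wave_mass_bound[of k l a b] assms unfolding E_def by linarith
qed

section \<open>Lower bound by the Cauchy-Schwarz inequality\<close>

text \<open>
  Two separate estimates with the same constant. For the \<open>B\<close> part it is the Cauchy-Schwarz inequality for
  \<open>B e\<^sub>1 = - \<Sum>\<^bsub>j \<noteq> e\<^sub>1\<^esub> B j\<close>. For the part with \<open>a\<close> it suffices that \<open>(\<Sum> 1 / len j) (\<Sum> len j) \<ge> 1\<close>, which
  the diagonal term of any single edge \<open>j\<^sub>0 \<noteq> e\<^sub>1\<close> already shows.
\<close>

lemma unobserved_amplitude_bound: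
  fixes len :: "'m::finite \<Rightarrow> real" and B :: "'m \<Rightarrow> complex"
  assumes pos: "\<And>e. 0 < len e" and "sum B UNIV = 0" and other: "j\<^sub>0 \<noteq> e\<^sub>1"
  shows "((cmod a)\<^sup>2 + (cmod (B e\<^sub>1))\<^sup>2) \<le>
    (\<Sum>j\<in>UNIV - {e\<^sub>1}. 1 / len j) * (\<Sum>j\<in>UNIV - {e\<^sub>1}. ((cmod a)\<^sup>2 + (cmod (B j))\<^sup>2) * len j)"
proof -
  let ?R = "UNIV - {e\<^sub>1}"
  let ?H = "\<Sum>j\<in>?R. 1 / len j"
  have "B e\<^sub>1 = - (\<Sum>j\<in>?R. B j)"
    using assms(2) sum.remove[of UNIV e\<^sub>1 B] by (simp add: eq_neg_iff_add_eq_0)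
  then have "cmod (B e\<^sub>1) \<le> (\<Sum>j\<in>?R. cmod (B j))" by (simp add: norm_sum)
  also have "\<dots> = (\<Sum>j\<in>?R. sqrt (1 / len j) * (sqrt (len j) * cmod (B j)))"
    using pos by (intro sum.cong) (simp_all add: real_sqrt_divide less_imp_le less_imp_neq[symmetric])
  finally have "(cmod (B e\<^sub>1))\<^sup>2 \<le> (\<Sum>j\<in>?R. sqrt (1 / len j) * (sqrt (len j) * cmod (B j)))\<^sup>2"
    by (intro power_mono) auto
  also have "\<dots> \<le> (\<Sum>j\<in>?R. (sqrt (1 / len j))\<^sup>2) * (\<Sum>j\<in>?R. (sqrt (len j) * cmod (B j))\<^sup>2)"
    by (rule Cauchy_Schwarz_ineq_sum)
  also have "\<dots> = ?H * (\<Sum>j\<in>?R. (cmod (B j))\<^sup>2 * len j)"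
    using pos by (simp add: power_mult_distrib less_imp_le mult.commute)
  finally have B: "(cmod (B e\<^sub>1))\<^sup>2 \<le> ?H * (\<Sum>j\<in>?R. (cmod (B j))\<^sup>2 * len j)" .
  have "1 = 1 / len j\<^sub>0 * len j\<^sub>0" using pos[of j\<^sub>0] by simp
  also have "\<dots> \<le> ?H * (\<Sum>j\<in>?R. len j)"
    using other pos by (intro mult_mono member_le_sum sum_nonneg) (auto simp: less_imp_le)
  finally have "(cmod a)\<^sup>2 * 1 \<le> (cmod a)\<^sup>2 * (?H * (\<Sum>j\<in>?R. len j))"
    by (intro mult_left_mono) auto
  also have "\<dots> = ?H * (\<Sum>j\<in>?R. (cmod a)\<^sup>2 * len j)"
    unfolding sum_distrib_left[symmetric] by (rule mult.left_commute)
  finally show ?thesis using B by (simp add: distrib_right sum.distrib distrib_left)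
qed

text \<open>
  Here \<open>\<eta>\<close> bounds the relative error of replacing the mass \<open>I e\<close> of an edge by its mean \<open>P e\<close>; as
  \<open>\<eta> \<rightarrow> 0\<close> the bound tends to \<open>1 / (1 + q)\<close>.
\<close>

lemma observed_mass_lower_bound:
  fixes len :: "'m::finite \<Rightarrow> real"
  assumes pos: "\<And>e. 0 < len e" and meas: "measurable_subset len \<omega>"
    and null: "measure lebesgue (\<omega> e\<^sub>1) = 0"
    and full: "\<And>j. j \<noteq> e\<^sub>1 \<Longrightarrow> measure lebesgue (\<omega> j) = len j"
    and other: "j\<^sub>0 \<noteq> e\<^sub>1" and q: "q = len e\<^sub>1 * (\<Sum>j\<in>UNIV - {e\<^sub>1}. 1 / len j)"
    and eig: "laplace_eigen theta_src theta_tgt len (k\<^sup>2) u" and norm: "L2norm len u = 1"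
    and k: "0 < k" "\<And>e. 2 / (k * len e) \<le> \<eta>" and "\<eta> < 1"
  shows "(1 - \<eta>) / ((1 - \<eta>) + (1 + \<eta>) * q) \<le> mass_on \<omega> u"
proof -
  let ?R = "UNIV - {e\<^sub>1}"
  obtain a B where B: "sum B UNIV = 0"
    "\<And>e x. x \<in> {0..len e} \<Longrightarrow> u e x = a * of_real (cos (k * x)) + B e * of_real (sin (k * x))"
    using theta_eigenfunction_wave[OF eig k(1)] by blast
  define I where "I = (\<lambda>e. set_lebesgue_integral lebesgue {0..len e} (\<lambda>x. (cmod (u e x))\<^sup>2))"
  define P where "P = (\<lambda>e. ((cmod a)\<^sup>2 + (cmod (B e))\<^sup>2) * len e / 2)"
  have IP: "\<bar>I e - P e\<bar> \<le> \<eta> * P e" for e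
    unfolding I_def P_def by (rule edge_mass_asymptotics[OF k(1) pos k(2) B(2)])
  have q0: "0 \<le> q" unfolding q using pos by (intro mult_nonneg_nonneg sum_nonneg) (auto simp: less_imp_le)
  have "0 < 2 / (k * len e\<^sub>1)" using k(1) pos[of e\<^sub>1] by simp
  then have \<eta>0: "0 < \<eta>" using k(2)[of e\<^sub>1] by linarith
  have S: "mass_on \<omega> u = (\<Sum>j\<in>?R. I j)"
    unfolding I_def by (rule mass_on_all_but_one_edge[OF meas pos null full continuous_on_eigenfunction[OF eig]])
  have "mass_on (\<lambda>e. {0..len e}) u = 1"
    using norm unfolding L2norm_def by simp
  then have "sum I UNIV = 1" unfolding mass_on_def I_def .
  then have tot: "I e\<^sub>1 + mass_on \<omega> u = 1"
    unfolding S by (subst sum.remove[symmetric]) auto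
  have "P e\<^sub>1 = ((cmod a)\<^sup>2 + (cmod (B e\<^sub>1))\<^sup>2) * (len e\<^sub>1 / 2)" by (simp add: P_def)
  also have "\<dots> \<le> ((\<Sum>j\<in>?R. 1 / len j) * (\<Sum>j\<in>?R. ((cmod a)\<^sup>2 + (cmod (B j))\<^sup>2) * len j)) * (len e\<^sub>1 / 2)"
    using pos[of e\<^sub>1] by (intro mult_right_mono unobserved_amplitude_bound[OF pos B(1) other]) auto
  also have "\<dots> = q * (\<Sum>j\<in>?R. P j)"
    unfolding P_def q sum_divide_distrib[symmetric] by simp
  finally have Pq: "P e\<^sub>1 \<le> q * (\<Sum>j\<in>?R. P j)" .
  have "(1 - \<eta>) * P e \<le> I e" for e
    using IP[of e] by (simp add: left_diff_distrib)
  then have "(\<Sum>j\<in>?R. (1 - \<eta>) * P j) \<le> mass_on \<omega> u"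
    unfolding S by (intro sum_mono)
  then have obs: "(1 - \<eta>) * (\<Sum>j\<in>?R. P j) \<le> mass_on \<omega> u" by (simp add: sum_distrib_left)
  have "I e\<^sub>1 \<le> (1 + \<eta>) * P e\<^sub>1" using IP[of e\<^sub>1] by (simp add: distrib_right)
  also have "\<dots> \<le> (1 + \<eta>) * (q * (\<Sum>j\<in>?R. P j))" using Pq \<eta>0 by (intro mult_left_mono) auto
  finally have "(1 - \<eta>) * I e\<^sub>1 \<le> (1 - \<eta>) * ((1 + \<eta>) * (q * (\<Sum>j\<in>?R. P j)))"
    using \<open>\<eta> < 1\<close> by (intro mult_left_mono) auto
  also have "\<dots> = ((1 + \<eta>) * q) * ((1 - \<eta>) * (\<Sum>j\<in>?R. P j))" by (simp add: mult_ac)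
  also have "\<dots> \<le> ((1 + \<eta>) * q) * mass_on \<omega> u" using obs \<eta>0 q0 by (intro mult_left_mono) auto
  finally have "(1 - \<eta>) * I e\<^sub>1 \<le> ((1 + \<eta>) * q) * mass_on \<omega> u" .
  moreover have "I e\<^sub>1 = 1 - mass_on \<omega> u" using tot by simp
  ultimately have "1 - \<eta> \<le> mass_on \<omega> u * ((1 - \<eta>) + (1 + \<eta>) * q)"
    by (simp add: algebra_simps)
  moreover have "0 < (1 - \<eta>) + (1 + \<eta>) * q"
    using \<open>\<eta> < 1\<close> \<eta>0 q0 by (intro add_pos_nonneg) auto
  ultimately show ?thesis by (simp add: pos_divide_le_eq)
qed

section \<open>Upper bound by resonances\<close>

lemma resonance_observed_mass:
  fixes len :: "'m::finite \<Rightarrow> real"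
  assumes pos: "\<And>e. 0 < len e" and meas: "measurable_subset len \<omega>"
    and null: "measure lebesgue (\<omega> e\<^sub>1) = 0"
    and full: "\<And>j. j \<noteq> e\<^sub>1 \<Longrightarrow> measure lebesgue (\<omega> j) = len j"
    and cos: "\<And>e. cos (k * len e / 2) \<noteq> 0" and tan: "(\<Sum>e\<in>UNIV. tan (k * len e / 2)) = 0"
    and k: "0 < k" "\<And>e. 2 / (k * len e) \<le> \<eta>" and "\<eta> < 1"
    and P: "\<And>e. P e = (1 + (tan (k * len e / 2))\<^sup>2) * len e / 2"
  shows "\<exists>u. laplace_eigen theta_src theta_tgt len (k\<^sup>2) u \<and> L2norm len u = 1 \<and>
    mass_on \<omega> u \<le> (1 + \<eta>) * sum P (UNIV - {e\<^sub>1}) /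
       ((1 + \<eta>) * sum P (UNIV - {e\<^sub>1}) + (1 - \<eta>) * P e\<^sub>1)"
proof -
  let ?R = "UNIV - {e\<^sub>1}"
  define v where "v = (\<lambda>(c::real) e x. complex_of_real c * of_real (cos (k * x))
      + (of_real c * of_real (tan (k * len e / 2))) * of_real (sin (k * x)))"
  have eig: "laplace_eigen theta_src theta_tgt len (k\<^sup>2) (v c)" for c
    unfolding v_def by (rule theta_resonance_eigenfunction[OF cos tan])
  have scale: "(cmod (v c e x))\<^sup>2 = c\<^sup>2 * (cmod (v 1 e x))\<^sup>2" for c e x
  proof -
    have "v c e x = of_real c * v 1 e x" by (simp add: v_def algebra_simps)
    then show ?thesis by (simp add: norm_mult power_mult_distrib)
  qed
  define I where "I = (\<lambda>e. set_lebesgue_integral lebesgue {0..len e} (\<lambda>x. (cmod (v 1 e x))\<^sup>2))"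
  have Ic: "set_lebesgue_integral lebesgue {0..len e} (\<lambda>x. (cmod (v c e x))\<^sup>2) = c\<^sup>2 * I e" for c e
    unfolding I_def scale[of c] by simp
  have mass: "mass_on \<omega> (v c) = c\<^sup>2 * sum I ?R" for c
    by (subst mass_on_all_but_one_edge[OF meas pos null full continuous_on_eigenfunction[OF eig]])
       (simp_all add: Ic sum_distrib_left)
  have "mass_on (\<lambda>e. {0..len e}) (v c) = c\<^sup>2 * sum I UNIV" for c
    unfolding mass_on_def Ic by (simp add: sum_distrib_left)
  then have norm: "L2norm len (v c) = sqrt (c\<^sup>2 * (I e\<^sub>1 + sum I ?R))" for c
    unfolding L2norm_def by (subst sum.remove[symmetric]) auto
  have IP: "\<bar>I e - P e\<bar> \<le> \<eta> * P e" for e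
    using edge_mass_asymptotics[OF k(1) pos k(2), of e "v 1 e" 1 "of_real (tan (k * len e / 2))"]
    unfolding I_def P by (simp add: v_def norm_power)
  have P0: "0 < P e" for e unfolding P using pos[of e] by (simp add: add_pos_nonneg)
  have "0 < 2 / (k * len e\<^sub>1)" using k(1) pos[of e\<^sub>1] by simp
  then have \<eta>0: "0 < \<eta>" using k(2)[of e\<^sub>1] by linarith
  have I_lower: "(1 - \<eta>) * P e \<le> I e" and I_upper: "I e \<le> (1 + \<eta>) * P e" for e
    using IP[of e] by (simp_all add: algebra_simps abs_le_iff)
  have up: "sum I ?R \<le> (1 + \<eta>) * sum P ?R"
    unfolding sum_distrib_left by (intro sum_mono I_upper)
  have I1: "0 < (1 - \<eta>) * P e\<^sub>1" using P0 \<open>\<eta> < 1\<close> by simp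
  have "0 \<le> I e" for e
    using P0[of e] \<open>\<eta> < 1\<close> by (intro order_trans[OF _ I_lower[of e]]) simp
  then have R0: "0 \<le> sum I ?R" by (intro sum_nonneg)
  define T where "T = I e\<^sub>1 + sum I ?R"
  have T: "0 < T" using I1 I_lower[of e\<^sub>1] R0 by (simp add: T_def)
  show ?thesis
  proof (intro exI conjI)
    show "laplace_eigen theta_src theta_tgt len (k\<^sup>2) (v (1 / sqrt T))" by (rule eig)
    have c: "(1 / sqrt T)\<^sup>2 = 1 / T" using T by (simp add: power_divide)
    show "L2norm len (v (1 / sqrt T)) = 1" unfolding norm c T_def[symmetric] using T by simp
    have "mass_on \<omega> (v (1 / sqrt T)) = sum I ?R / T" unfolding mass c by simp
    also have "\<dots> \<le> (1 + \<eta>) * sum P ?R / ((1 + \<eta>) * sum P ?R + (1 - \<eta>) * P e\<^sub>1)"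
    proof -
      define X where "X = (1 + \<eta>) * sum P ?R"
      have "sum I ?R * ((1 - \<eta>) * P e\<^sub>1) \<le> X * I e\<^sub>1"
        using up I_lower R0 I1 unfolding X_def by (intro mult_mono) auto
      then have "sum I ?R * (X + (1 - \<eta>) * P e\<^sub>1) \<le> X * T"
        by (simp add: T_def algebra_simps)
      moreover have "0 < X + (1 - \<eta>) * P e\<^sub>1" using up R0 I1 unfolding X_def by linarith
      ultimately show ?thesis unfolding X_def[symmetric] using T
        by (simp add: pos_divide_le_eq pos_le_divide_eq)
    qed
    finally show "mass_on \<omega> (v (1 / sqrt T)) \<le>
       (1 + \<eta>) * sum P ?R / ((1 + \<eta>) * sum P ?R + (1 - \<eta>) * P e\<^sub>1)" .
  qed
qed

text \<open>
  Along resonances \<open>k n \<rightarrow> \<infinity>\<close> whose tangents converge to \<open>t\<close>, the observed mass is never below \<open>I\<close> and has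
  an upper bound converging to the right-hand side. The number \<open>I\<close> is any lower bound of the observed masses of
  normalised solutions with \<open>\<mu> \<ge> \<Lambda>\<close>, rather than their infimum, so that the same statement also shows
  that such solutions exist.
\<close>

lemma resonant_amplitudes_bound_infimum:
  fixes len t :: "'m::finite \<Rightarrow> real"
  assumes pos: "\<And>e. 0 < len e" and ri: "rationally_independent len" and meas: "measurable_subset len \<omega>"
    and null: "measure lebesgue (\<omega> e\<^sub>1) = 0"
    and full: "\<And>j. j \<noteq> e\<^sub>1 \<Longrightarrow> measure lebesgue (\<omega> j) = len j"
    and t: "(\<Sum>e\<in>UNIV. t e) = 0"
    and lower: "\<And>u \<mu>. laplace_eigen theta_src theta_tgt len \<mu> u \<Longrightarrow> \<Lambda> \<le> \<mu> \<Longrightarrow> L2norm len u = 1 \<Longrightarrow>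
      I \<le> mass_on \<omega> u"
    and P: "\<And>e. P e = (1 + (t e)\<^sup>2) * len e / 2"
  shows "I \<le> sum P (UNIV - {e\<^sub>1}) / (sum P (UNIV - {e\<^sub>1}) + P e\<^sub>1)"
proof -
  let ?R = "UNIV - {e\<^sub>1}"
  define C where "C = (\<Sum>e\<in>UNIV. 2 / len e)"
  have C: "2 / len e \<le> C" for e
    unfolding C_def using pos by (intro member_le_sum) (auto simp: less_imp_le)
  have C0: "0 < C" by (rule less_le_trans[OF _ C[of e\<^sub>1]]) (simp add: pos)
  have "\<exists>k. C + \<bar>\<Lambda>\<bar> + 1 + real n \<le> k \<and> (\<Sum>e\<in>UNIV. tan (k * len e / 2)) = 0 \<and>
      (\<forall>e. cos (k * len e / 2) \<noteq> 0) \<and> (\<forall>e. \<bar>tan (k * len e / 2) - t e\<bar> < inverse (real (Suc n)))" for n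
    by (rule resonance_near[OF pos ri t, of "inverse (real (Suc n))" "C + \<bar>\<Lambda>\<bar> + 1 + real n"]) (simp, blast)
  then obtain k where k: "\<And>n. C + \<bar>\<Lambda>\<bar> + 1 + real n \<le> k n"
    and tan: "\<And>n. (\<Sum>e\<in>UNIV. tan (k n * len e / 2)) = 0"
    and cos: "\<And>n e. cos (k n * len e / 2) \<noteq> 0"
    and near: "\<And>n e. \<bar>tan (k n * len e / 2) - t e\<bar> < inverse (real (Suc n))" by metis
  have k0: "0 < k n" "C < k n" "1 \<le> k n" "\<Lambda> \<le> k n" "real n \<le> k n" for n
    using k[of n] C0 by linarith+
  define Q where "Q = (\<lambda>n e. (1 + (tan (k n * len e / 2))\<^sup>2) * len e / 2)"
  have bound: "I \<le> (1 + C / k n) * sum (Q n) ?R / ((1 + C / k n) * sum (Q n) ?R + (1 - C / k n) * Q n e\<^sub>1)" for n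
  proof -
    have "2 / (k n * len e) \<le> C / k n" for e
      using divide_right_mono[OF C[of e], of "k n"] k0[of n] by (simp add: mult.commute)
    moreover have "C / k n < 1" using k0[of n] by simp
    ultimately have "\<exists>u. laplace_eigen theta_src theta_tgt len ((k n)\<^sup>2) u \<and> L2norm len u = 1 \<and>
      mass_on \<omega> u \<le> (1 + C / k n) * sum (Q n) ?R / ((1 + C / k n) * sum (Q n) ?R + (1 - C / k n) * Q n e\<^sub>1)"
      by (intro resonance_observed_mass[OF pos meas null full cos tan k0(1)]) (simp_all add: Q_def)
    then obtain u where u: "laplace_eigen theta_src theta_tgt len ((k n)\<^sup>2) u" "L2norm len u = 1"
      "mass_on \<omega> u \<le> (1 + C / k n) * sum (Q n) ?R / ((1 + C / k n) * sum (Q n) ?R + (1 - C / k n) * Q n e\<^sub>1)"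
      by blast
    have "k n * 1 \<le> (k n)\<^sup>2" unfolding power2_eq_square using k0[of n] by (intro mult_left_mono) auto
    then have "\<Lambda> \<le> (k n)\<^sup>2" using k0(4)[of n] by linarith
    then show ?thesis using lower[OF u(1) _ u(2)] u(3) by linarith
  qed
  have "(\<lambda>n. tan (k n * len e / 2) - t e) \<longlonglongrightarrow> 0" for e
    by (rule Lim_null_comparison[OF _ LIMSEQ_inverse_real_of_nat])
       (use near[of _ e] in \<open>auto intro!: always_eventually simp: less_imp_le\<close>)
  then have lim_tan: "(\<lambda>n. tan (k n * len e / 2)) \<longlonglongrightarrow> t e" for e
    by (simp add: LIM_zero_iff)
  have "filterlim k at_top sequentially"
    by (rule filterlim_at_top_mono[OF filterlim_real_sequentially]) (simp add: k0(5))
  then have lim_C: "(\<lambda>n. C / k n) \<longlonglongrightarrow> 0"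
    by (rule real_tendsto_divide_at_top[OF tendsto_const])
  have lim_Q: "(\<lambda>n. Q n e) \<longlonglongrightarrow> P e" for e
    unfolding Q_def P by (intro tendsto_intros lim_tan) auto
  have P0: "0 < P e" for e unfolding P using pos[of e] by (simp add: add_pos_nonneg)
  have den: "sum P ?R + P e\<^sub>1 \<noteq> 0"
    using P0 by (intro less_imp_neq[symmetric] add_nonneg_pos sum_nonneg) (auto simp: less_imp_le)
  have "(\<lambda>n. (1 + C / k n) * sum (Q n) ?R / ((1 + C / k n) * sum (Q n) ?R + (1 - C / k n) * Q n e\<^sub>1))
      \<longlonglongrightarrow> (1 + 0) * sum P ?R / ((1 + 0) * sum P ?R + (1 - 0) * P e\<^sub>1)"
    by (intro tendsto_intros lim_C lim_Q) (use den in simp)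
  then show ?thesis
    using LIMSEQ_le_const[where a = I] bound by fastforce
qed

text \<open>
  The amplitudes \<open>t j = s / len j\<close> give equality in the Cauchy-Schwarz inequality, but the common vertex
  value 1 still contributes \<open>len j\<close> to the energy of each edge. Dividing the energies by \<open>s\<^sup>2\<close> exposes
  this contribution as a multiple of \<open>r = 1 / s\<^sup>2\<close>, which tends to zero along \<open>s = sqrt (n + 1)\<close>.
\<close>

lemma infimum_le_limit_constant:
  fixes len :: "'m::finite \<Rightarrow> real"
  assumes pos: "\<And>e. 0 < len e" and ri: "rationally_independent len" and meas: "measurable_subset len \<omega>"
    and null: "measure lebesgue (\<omega> e\<^sub>1) = 0"
    and full: "\<And>j. j \<noteq> e\<^sub>1 \<Longrightarrow> measure lebesgue (\<omega> j) = len j"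
    and H: "H = (\<Sum>j\<in>UNIV - {e\<^sub>1}. 1 / len j)" "0 < H"
    and lower: "\<And>u \<mu>. laplace_eigen theta_src theta_tgt len \<mu> u \<Longrightarrow> \<Lambda> \<le> \<mu> \<Longrightarrow> L2norm len u = 1 \<Longrightarrow>
      I \<le> mass_on \<omega> u"
  shows "I \<le> 1 / (1 + len e\<^sub>1 * H)"
proof -
  let ?R = "UNIV - {e\<^sub>1}"
  define L where "L = (\<Sum>j\<in>?R. len j)"
  define r where "r = (\<lambda>n. inverse (real (Suc n)))"
  have bound: "I \<le> (L * r n + H) / ((L * r n + H) + len e\<^sub>1 * (r n + H\<^sup>2))" for n
  proof -
    define s where "s = sqrt (real (Suc n))"
    have s: "s\<^sup>2 = real (Suc n)" by (simp add: s_def)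
    define t where "t = (\<lambda>e. if e = e\<^sub>1 then - s * H else s / len e)"
    define P where "P = (\<lambda>e. (1 + (t e)\<^sup>2) * len e / 2)"
    have "sum t ?R = s * H" unfolding H sum_distrib_left by (intro sum.cong) (auto simp: t_def)
    then have "sum t UNIV = 0" by (subst sum.remove[of _ e\<^sub>1]) (auto simp: t_def)
    then have "I \<le> sum P ?R / (sum P ?R + P e\<^sub>1)"
      by (intro resonant_amplitudes_bound_infimum[OF pos ri meas null full, where t = t and \<Lambda> = \<Lambda>])
         (auto simp: P_def intro: lower)
    also have "sum P ?R = (\<Sum>j\<in>?R. len j / 2 + s\<^sup>2 / 2 * (1 / len j))"
      using pos by (intro sum.cong refl) (simp add: P_def t_def field_simps power2_eq_square less_imp_neq[symmetric])
    also have "\<dots> = L / 2 + s\<^sup>2 / 2 * H"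
      unfolding H L_def by (simp only: sum.distrib sum_distrib_left sum_divide_distrib)
    also have "\<dots> = (s\<^sup>2 * r n) * L / 2 + s\<^sup>2 / 2 * H" by (simp add: s r_def)
    also have "\<dots> = s\<^sup>2 / 2 * (L * r n + H)" by (simp add: field_simps)
    also have "P e\<^sub>1 = s\<^sup>2 / 2 * (len e\<^sub>1 * (r n + H\<^sup>2))"
      unfolding P_def t_def power_mult_distrib by (simp add: s r_def field_simps)
    also have "s\<^sup>2 / 2 * (L * r n + H) / (s\<^sup>2 / 2 * (L * r n + H) + s\<^sup>2 / 2 * (len e\<^sub>1 * (r n + H\<^sup>2)))
        = (L * r n + H) / ((L * r n + H) + len e\<^sub>1 * (r n + H\<^sup>2))"
      unfolding distrib_left[symmetric] s by simp
    finally show ?thesis .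
  qed
  have den: "0 < H + len e\<^sub>1 * H\<^sup>2"
    using H(2) pos[of e\<^sub>1] by (intro add_pos_pos mult_pos_pos) auto
  have r: "r \<longlonglongrightarrow> 0" unfolding r_def by (rule LIMSEQ_inverse_real_of_nat)
  have "(\<lambda>n. (L * r n + H) / ((L * r n + H) + len e\<^sub>1 * (r n + H\<^sup>2)))
     \<longlonglongrightarrow> (L * 0 + H) / ((L * 0 + H) + len e\<^sub>1 * (0 + H\<^sup>2))"
    by (intro tendsto_intros r) (use den in simp)
  then have "I \<le> (L * 0 + H) / ((L * 0 + H) + len e\<^sub>1 * (0 + H\<^sup>2))"
    using LIMSEQ_le_const[where a = I] bound by blast
  also have "\<dots> = H * 1 / (H * (1 + len e\<^sub>1 * H))" by (simp add: algebra_simps power2_eq_square)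
  also have "\<dots> = 1 / (1 + len e\<^sub>1 * H)" using H(2) by (intro mult_divide_mult_cancel_left) simp
  finally show ?thesis .
qed

section \<open>The limit constant\<close>

text \<open>
  The infimum over \<open>\<mu> \<ge> \<Lambda>\<close> is squeezed between the lower bound at relative error \<open>\<eta> = C / sqrt \<Lambda>\<close>
  and its limit \<open>1 / (1 + q)\<close>, which is an upper bound for every \<open>\<Lambda>\<close>.
\<close>

lemma C_infty_theta_unobserved_edge:
  fixes len :: "'m::finite \<Rightarrow> real"
  assumes pos: "\<And>e. 0 < len e" and ri: "rationally_independent len" and meas: "measurable_subset len \<omega>"
    and null: "measure lebesgue (\<omega> e\<^sub>1) = 0"
    and full: "\<And>j. j \<noteq> e\<^sub>1 \<Longrightarrow> measure lebesgue (\<omega> j) = len j"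
    and other: "j\<^sub>0 \<noteq> e\<^sub>1"
  shows "C_infty theta_src theta_tgt \<omega> len = 1 / (1 + len e\<^sub>1 * (\<Sum>j\<in>UNIV - {e\<^sub>1}. 1 / len j))"
proof -
  define H where "H = (\<Sum>j\<in>UNIV - {e\<^sub>1}. 1 / len j)"
  define q where "q = len e\<^sub>1 * H"
  have H0: "0 < H" unfolding H_def using pos other by (intro sum_pos2[of _ j\<^sub>0]) (auto simp: less_imp_le)
  have q0: "0 < q" using H0 pos by (simp add: q_def)
  define X where "X = (\<lambda>\<Lambda>. {mass_on \<omega> u | u \<mu>. laplace_eigen theta_src theta_tgt len \<mu> u \<and> \<Lambda> \<le> \<mu> \<and> L2norm len u = 1})"
  define C where "C = (\<Sum>e\<in>UNIV. 2 / len e)"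
  have C: "2 / len e \<le> C" for e
    unfolding C_def using pos by (intro member_le_sum) (auto simp: less_imp_le)
  have C0: "0 < C" by (rule less_le_trans[OF _ C[of e\<^sub>1]]) (simp add: pos)
  define g where "g = (\<lambda>\<eta>. (1 - \<eta>) / ((1 - \<eta>) + (1 + \<eta>) * q))"
  have lower: "g (C / sqrt \<Lambda>) \<le> mass_on \<omega> u"
    if "C\<^sup>2 < \<Lambda>" "laplace_eigen theta_src theta_tgt len \<mu> u" "\<Lambda> \<le> \<mu>" "L2norm len u = 1" for \<Lambda> \<mu> u
  proof -
    have \<Lambda>: "0 < \<Lambda>" using that(1) zero_le_power2[of C] by linarith
    have "C < sqrt \<Lambda>" using that(1) by (rule real_less_rsqrt)
    have "2 / (sqrt \<mu> * len e) \<le> C / sqrt \<Lambda>" for e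
    proof -
      have "2 / (sqrt \<mu> * len e) = 2 / len e / sqrt \<mu>" by (simp add: mult.commute)
      also have "\<dots> \<le> C / sqrt \<Lambda>" using C[of e] \<Lambda> \<open>\<Lambda> \<le> \<mu>\<close> C0 by (intro frac_le) auto
      finally show ?thesis .
    qed
    moreover have "C / sqrt \<Lambda> < 1" using \<open>C < sqrt \<Lambda>\<close> \<Lambda> by simp
    moreover have "laplace_eigen theta_src theta_tgt len ((sqrt \<mu>)\<^sup>2) u" "0 < sqrt \<mu>"
      using that \<Lambda> by simp_all
    ultimately show ?thesis unfolding g_def q_def
      using observed_mass_lower_bound[OF pos meas null full other _ _ that(4)] H_def by blast
  qed
  have ne: "X \<Lambda> \<noteq> {}" for \<Lambda>
  proof
    \<comment> \<open>If there were no solutions, then 2 would be a lower bound of their observed masses.\<close>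
    assume "X \<Lambda> = {}"
    then have "2 \<le> 1 / (1 + len e\<^sub>1 * H)"
      by (intro infimum_le_limit_constant[OF pos ri meas null full H_def H0, of \<Lambda>]) (auto simp: X_def)
    then show False using q0 by (simp add: q_def divide_simps split: if_splits)
  qed
  have "0 \<le> mass_on \<omega> u" for u
    unfolding mass_on_def set_lebesgue_integral_def
    by (intro sum_nonneg integral_nonneg_AE) auto
  then have bdd: "bdd_below (X \<Lambda>)" for \<Lambda> by (intro bdd_belowI[of _ 0]) (auto simp: X_def)
  have upper: "Inf (X \<Lambda>) \<le> 1 / (1 + q)" for \<Lambda>
    unfolding q_def
    by (rule infimum_le_limit_constant[OF pos ri meas null full H_def H0, of \<Lambda>])
       (assumption, rule cInf_lower[OF _ bdd], unfold X_def, blast)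
  have "((\<lambda>\<Lambda>. C / sqrt \<Lambda>) \<longlongrightarrow> 0) at_top"
    by (rule real_tendsto_divide_at_top[OF tendsto_const sqrt_at_top])
  then have "((\<lambda>\<Lambda>. g (C / sqrt \<Lambda>)) \<longlongrightarrow> (1 - 0) / ((1 - 0) + (1 + 0) * q)) at_top"
    unfolding g_def by (intro tendsto_intros) (use q0 in auto)
  then have lim: "((\<lambda>\<Lambda>. g (C / sqrt \<Lambda>)) \<longlongrightarrow> 1 / (1 + q)) at_top" by simp
  have g_le: "\<forall>\<^sub>F \<Lambda> in at_top. g (C / sqrt \<Lambda>) \<le> Inf (X \<Lambda>)"
    using eventually_gt_at_top[of "C\<^sup>2"]
  proof eventually_elim
    case (elim \<Lambda>)
    show ?case using lower[OF elim] by (intro cInf_greatest ne) (auto simp: X_def)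
  qed
  have le: "\<forall>\<^sub>F \<Lambda> in at_top. Inf (X \<Lambda>) \<le> 1 / (1 + q)"
    by (simp add: upper)
  have "((\<lambda>\<Lambda>. Inf (X \<Lambda>)) \<longlongrightarrow> 1 / (1 + q)) at_top"
    by (rule tendsto_sandwich[OF g_le le lim tendsto_const])
  then have "Lim at_top (\<lambda>\<Lambda>. Inf (X \<Lambda>)) = 1 / (1 + q)"
    by (intro tendsto_Lim) auto
  then show ?thesis unfolding C_infty_def X_def q_def H_def .
qed

theorem corollary3p7:
  fixes len :: "'m::finite \<Rightarrow> real"
    and \<omega> :: "'m \<Rightarrow> real set"
    and \<alpha> :: "'m \<Rightarrow> real"
    and H\<^sub>1 :: real
    and e\<^sub>1 :: 'm
  assumes m: "CARD('m) \<ge> 3"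
    and pos: "\<And>j. 0 < len j"
    and gen: "len \<in> generic_class theta_src theta_tgt"
    and meas: "measurable_subset len \<omega>"
    and alpha: "\<And>j. \<alpha> j = measure lebesgue (\<omega> j)"
    and unobserved: "\<alpha> e\<^sub>1 = 0"
    and observed: "\<And>j. j \<noteq> e\<^sub>1 \<Longrightarrow> \<alpha> j = len j"
    and H: "H\<^sub>1 = (\<Sum>j\<in>UNIV - {e\<^sub>1}. 1 / len j)"
  shows "C_infty theta_src theta_tgt \<omega> len = 1 / (1 + len e\<^sub>1 * H\<^sub>1)
    \<and> C_infty theta_src theta_tgt \<omega> len < Min ((\<lambda>j. len j / (len e\<^sub>1 + len j)) ` (UNIV - {e\<^sub>1}))
    \<and> (\<forall>j. j \<noteq> e\<^sub>1 \<longrightarrow> C_infty theta_src theta_tgt \<omega> len < (\<alpha> e\<^sub>1 + \<alpha> j) / (len e\<^sub>1 + len j))"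
proof -
  let ?C = "C_infty theta_src theta_tgt \<omega> len"
  have "UNIV \<noteq> {e\<^sub>1}"
  proof
    assume "UNIV = {e\<^sub>1}"
    then have "CARD('m) = card {e\<^sub>1}" by (rule arg_cong)
    then show False using m by simp
  qed
  then obtain j\<^sub>0 where j\<^sub>0: "j\<^sub>0 \<noteq> e\<^sub>1" by blast
  have null: "measure lebesgue (\<omega> e\<^sub>1) = 0" using unobserved alpha by simp
  have full: "measure lebesgue (\<omega> j) = len j" if "j \<noteq> e\<^sub>1" for j
    using observed[OF that] alpha by simp
  have ri: "rationally_independent len" using gen by (simp add: generic_class_def)
  have C: "?C = 1 / (1 + len e\<^sub>1 * H\<^sub>1)"
    unfolding H by (rule C_infty_theta_unobserved_edge[OF pos ri meas null full j\<^sub>0])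
  have strict: "?C < len j / (len e\<^sub>1 + len j)" if j: "j \<noteq> e\<^sub>1" for j
  proof -
    have "card (UNIV - {e\<^sub>1} - {j}) = CARD('m) - 2"
      using j by (simp add: card_Diff_singleton)
    then have "card (UNIV - {e\<^sub>1} - {j}) \<noteq> 0" using m by linarith
    then have "UNIV - {e\<^sub>1} - {j} \<noteq> {}" by (metis card.empty)
    then have "0 < (\<Sum>i\<in>UNIV - {e\<^sub>1} - {j}. 1 / len i)" using pos by (intro sum_pos) auto
    then have "1 / len j < H\<^sub>1" unfolding H using j by (subst sum.remove[of _ j]) auto
    then have "len e\<^sub>1 * (1 / len j) < len e\<^sub>1 * H\<^sub>1" using pos by (intro mult_strict_left_mono)
    moreover have "0 < len e\<^sub>1 * (1 / len j)" using pos by simp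
    ultimately have "1 / (1 + len e\<^sub>1 * H\<^sub>1) < 1 / (1 + len e\<^sub>1 * (1 / len j))"
      by (intro divide_strict_left_mono mult_pos_pos) linarith+
    also have "\<dots> = len j / (len e\<^sub>1 + len j)"
      using pos[of e\<^sub>1] pos[of j] by (simp add: field_simps)
    finally show ?thesis unfolding C .
  qed
  have "?C < Min ((\<lambda>j. len j / (len e\<^sub>1 + len j)) ` (UNIV - {e\<^sub>1}))"
    using strict j\<^sub>0 by (subst Min_gr_iff) auto
  then show ?thesis
    using C strict observed unobserved by simp
qed

end
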